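(* Let $X$ be a finite set with $|X|=n$, and let $a\in\mathcal T_X$ be an idempotent with $r=\operatorname{rank}(a)$, where $1<r<n$. Put $A=\operatorname{im}(a)$ and $\alpha=\ker(a)$. Let $\psi_1:\operatorname{Reg}(\mathcal T_X^a)\to\operatorname{Reg}(\mathcal T(X,A)):f\mapsto fa$ and $\psi_2:\operatorname{Reg}(\mathcal T_X^a)\to\operatorname{Reg}(\mathcal T(X,\alpha)):f\mapsto af$. The maps $$\phi_1:\operatorname{Reg}(\mathcal T(X,A))\to\mathcal T_A:g\mapsto g|_A\qquad\text{and}\qquad\phi_2:\operatorname{Reg}(\mathcal T(X,\alpha))\to\mathcal T_A:g\mapsto(ga)|_A$$ are epimorphisms, and the square formed by $\psi_1,\psi_2,\phi_1,\phi_2$ commutes, i.e. $(f\psi_1)\phi_1=(f\psi_2)\phi_2$ for all $f\in\operatorname{Reg}(\mathcal T_X^a)$. Further, the induced map $\operatorname{Reg}(\mathcal T_X^a)\to\mathcal T_A$, $f\mapsto (f\psi_1)\phi_1=(f\psi_2)\phi_2$, is an epimorphism.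
   Context: For a set $Y$, $\mathcal T_Y$ is the full transformation semigroup of all maps $Y\to Y$ under composition; maps are written on the right and composed from left to right. $\operatorname{im}(f)=\{xf:x\in X\}$, $\ker(f)=\{(x,y):xf=yf\}$, $\operatorname{rank}(f)=|\operatorname{im}(f)|$. The variant $\mathcal T_X^a$ is the semigroup with underlying set $\mathcal T_X$ and operation $f\star g=fag$. $\mathcal T(X,A)=\{f\in\mathcal T_X:\operatorname{im}(f)\subseteq A\}$ and $\mathcal T(X,\alpha)=\{f\in\mathcal T_X:\ker(f)\supseteq\alpha\}$ are subsemigroups of $\mathcal T_X$ under composition. $\operatorname{Reg}(S)$ is the set of regular elements of a semigroup $S$ ($x$ is regular if $x=xyx$ and $y=yxy$ for some $y\in S$). $\operatorname{Reg}(\mathcal T_X^a)$ is a subsemigroup of $\mathcal T_X^a$, with operation $\star$; $\operatorname{Reg}(\mathcal T(X,A))$ and $\operatorname{Reg}(\mathcal T(X,\alpha))$ are semigroups under composition. The maps $\psi_1,\psi_2$ are well-defined homomorphisms. An epimorphism here means a surjective homomorphism. *)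

theory Defs
  imports "HOL-Algebra.Group"
begin

text \<open>
  Semigroups are represented by the record type of monoids from \<^theory>\<open>HOL-Algebra.Group\<close>.
  Its unit field is ignored by \<^const>\<open>hom\<close>, \<^const>\<open>epi\<close> and all definitions below; it need not
  be an identity element of the semigroup (it usually is not for variants and subsemigroups).

  Maps on a set are extensional functions, so that maps agreeing on the set are equal.
  Multiplication is composition from left to right: the product of \<open>f\<close> and \<open>g\<close> sends \<open>x\<close> to
  \<open>g (f x)\<close>.
\<close>

definition full_trans :: "'a set \<Rightarrow> ('a \<Rightarrow> 'a) monoid" where
  "full_trans Y =
     \<lparr>carrier = Y \<rightarrow>\<^sub>E Y, mult = (\<lambda>f g. compose Y g f), one = (\<lambda>y\<in>Y. y)\<rparr>"

definition map_im :: "'a set \<Rightarrow> ('a \<Rightarrow> 'a) \<Rightarrow> 'a set" where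
  "map_im X f = f ` X"

definition map_ker :: "'a set \<Rightarrow> ('a \<Rightarrow> 'a) \<Rightarrow> ('a \<times> 'a) set" where
  "map_ker X f = {(x, y). x \<in> X \<and> y \<in> X \<and> f x = f y}"

definition map_rank :: "'a set \<Rightarrow> ('a \<Rightarrow> 'a) \<Rightarrow> nat" where
  "map_rank X f = card (map_im X f)"

definition variant :: "('s, 'm) monoid_scheme \<Rightarrow> 's \<Rightarrow> ('s, 'm) monoid_scheme" where
  "variant S a = S\<lparr>mult := (\<lambda>f g. f \<otimes>\<^bsub>S\<^esub> a \<otimes>\<^bsub>S\<^esub> g)\<rparr>"

definition trans_im :: "'a set \<Rightarrow> 'a set \<Rightarrow> ('a \<Rightarrow> 'a) monoid" where
  "trans_im X A =
     (full_trans X)\<lparr>carrier := {f \<in> carrier (full_trans X). map_im X f \<subseteq> A}\<rparr>"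

definition trans_ker :: "'a set \<Rightarrow> ('a \<times> 'a) set \<Rightarrow> ('a \<Rightarrow> 'a) monoid" where
  "trans_ker X \<alpha> =
     (full_trans X)\<lparr>carrier := {f \<in> carrier (full_trans X). \<alpha> \<subseteq> map_ker X f}\<rparr>"

definition regular_elem :: "('s, 'm) monoid_scheme \<Rightarrow> 's \<Rightarrow> bool" where
  "regular_elem S x \<longleftrightarrow>
     (\<exists>y\<in>carrier S. x = x \<otimes>\<^bsub>S\<^esub> y \<otimes>\<^bsub>S\<^esub> x \<and> y = y \<otimes>\<^bsub>S\<^esub> x \<otimes>\<^bsub>S\<^esub> y)"

definition Reg :: "('s, 'm) monoid_scheme \<Rightarrow> ('s, 'm) monoid_scheme" where
  "Reg S = S\<lparr>carrier := {x \<in> carrier S. regular_elem S x}\<rparr>"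

text \<open>
  Each of the following maps is the stated formula on its domain and \<^const>\<open>undefined\<close> elsewhere.
\<close>

definition psi1 :: "'a set \<Rightarrow> ('a \<Rightarrow> 'a) \<Rightarrow> ('a \<Rightarrow> 'a) \<Rightarrow> ('a \<Rightarrow> 'a)" where
  "psi1 X a = (\<lambda>f \<in> carrier (Reg (variant (full_trans X) a)). f \<otimes>\<^bsub>full_trans X\<^esub> a)"

definition psi2 :: "'a set \<Rightarrow> ('a \<Rightarrow> 'a) \<Rightarrow> ('a \<Rightarrow> 'a) \<Rightarrow> ('a \<Rightarrow> 'a)" where
  "psi2 X a = (\<lambda>f \<in> carrier (Reg (variant (full_trans X) a)). a \<otimes>\<^bsub>full_trans X\<^esub> f)"

definition phi1 :: "'a set \<Rightarrow> ('a \<Rightarrow> 'a) \<Rightarrow> ('a \<Rightarrow> 'a) \<Rightarrow> ('a \<Rightarrow> 'a)" where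
  "phi1 X a = (\<lambda>g \<in> carrier (Reg (trans_im X (map_im X a))). restrict g (map_im X a))"

definition phi2 :: "'a set \<Rightarrow> ('a \<Rightarrow> 'a) \<Rightarrow> ('a \<Rightarrow> 'a) \<Rightarrow> ('a \<Rightarrow> 'a)" where
  "phi2 X a = (\<lambda>g \<in> carrier (Reg (trans_ker X (map_ker X a))).
                 restrict (g \<otimes>\<^bsub>full_trans X\<^esub> a) (map_im X a))"

lemma monoid_full_trans: "monoid (full_trans X)"
proof (rule monoidI)
  show "f \<otimes>\<^bsub>full_trans X\<^esub> g \<otimes>\<^bsub>full_trans X\<^esub> h = f \<otimes>\<^bsub>full_trans X\<^esub> (g \<otimes>\<^bsub>full_trans X\<^esub> h)"
    if "f \<in> carrier (full_trans X)" "g \<in> carrier (full_trans X)" "h \<in> carrier (full_trans X)"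
    for f g h
    using that by (auto simp: full_trans_def compose_def fun_eq_iff)
qed (auto simp: full_trans_def compose_def fun_eq_iff PiE_def Pi_def extensional_def)

lemma full_trans_regular:
  assumes f: "f \<in> carrier (full_trans X)"
  shows "\<exists>u\<in>carrier (full_trans X). f \<otimes>\<^bsub>full_trans X\<^esub> u \<otimes>\<^bsub>full_trans X\<^esub> f = f"
proof
  let ?u = "\<lambda>y\<in>X. if y \<in> f ` X then inv_into X f y else y"
  show "?u \<in> carrier (full_trans X)"
    by (auto simp: full_trans_def inv_into_into)
  show "f \<otimes>\<^bsub>full_trans X\<^esub> ?u \<otimes>\<^bsub>full_trans X\<^esub> f = f"
    using f by (auto simp: full_trans_def compose_def fun_eq_iff f_inv_into_f PiE_def Pi_def extensional_def)
qed

lemma variant_reg_closed: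
  assumes a: "a \<in> carrier (full_trans X)"
    and f: "f \<in> carrier (Reg (variant (full_trans X) a))"
    and g: "g \<in> carrier (Reg (variant (full_trans X) a))"
  shows "f \<otimes>\<^bsub>full_trans X\<^esub> a \<otimes>\<^bsub>full_trans X\<^esub> g \<in> carrier (Reg (variant (full_trans X) a))"
proof -
  interpret monoid "full_trans X" by (rule monoid_full_trans)
  let ?S = "full_trans X"
  from f obtain x where fx: "f \<in> carrier ?S" "x \<in> carrier ?S"
      and fe: "f = f \<otimes>\<^bsub>?S\<^esub> a \<otimes>\<^bsub>?S\<^esub> x \<otimes>\<^bsub>?S\<^esub> a \<otimes>\<^bsub>?S\<^esub> f"
    by (auto simp: Reg_def regular_elem_def variant_def)
  from g obtain y where gy: "g \<in> carrier ?S" "y \<in> carrier ?S"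
      and ge: "g = g \<otimes>\<^bsub>?S\<^esub> a \<otimes>\<^bsub>?S\<^esub> y \<otimes>\<^bsub>?S\<^esub> a \<otimes>\<^bsub>?S\<^esub> g"
    by (auto simp: Reg_def regular_elem_def variant_def)
  have fe': "f \<otimes>\<^bsub>?S\<^esub> (a \<otimes>\<^bsub>?S\<^esub> (x \<otimes>\<^bsub>?S\<^esub> (a \<otimes>\<^bsub>?S\<^esub> (f \<otimes>\<^bsub>?S\<^esub> w)))) = f \<otimes>\<^bsub>?S\<^esub> w"
    if "w \<in> carrier ?S" for w
    using arg_cong[OF fe[symmetric], of "\<lambda>t. t \<otimes>\<^bsub>?S\<^esub> w"] that a fx by (simp add: m_assoc)
  have ge0: "g \<otimes>\<^bsub>?S\<^esub> (a \<otimes>\<^bsub>?S\<^esub> (y \<otimes>\<^bsub>?S\<^esub> (a \<otimes>\<^bsub>?S\<^esub> g))) = g"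
    using ge[symmetric] a gy by (simp add: m_assoc)
  have ge': "g \<otimes>\<^bsub>?S\<^esub> (a \<otimes>\<^bsub>?S\<^esub> (y \<otimes>\<^bsub>?S\<^esub> (a \<otimes>\<^bsub>?S\<^esub> (g \<otimes>\<^bsub>?S\<^esub> w)))) = g \<otimes>\<^bsub>?S\<^esub> w"
    if "w \<in> carrier ?S" for w
    using arg_cong[OF ge[symmetric], of "\<lambda>t. t \<otimes>\<^bsub>?S\<^esub> w"] that a gy by (simp add: m_assoc)
  define h where "h = f \<otimes>\<^bsub>?S\<^esub> a \<otimes>\<^bsub>?S\<^esub> g"
  define p where "p = a \<otimes>\<^bsub>?S\<^esub> x \<otimes>\<^bsub>?S\<^esub> a \<otimes>\<^bsub>?S\<^esub> h \<otimes>\<^bsub>?S\<^esub> a \<otimes>\<^bsub>?S\<^esub> y \<otimes>\<^bsub>?S\<^esub> a"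
  have hp: "h \<in> carrier ?S" "p \<in> carrier ?S"
    using a fx gy by (auto simp: h_def p_def)
  obtain u where u: "u \<in> carrier ?S" "p \<otimes>\<^bsub>?S\<^esub> u \<otimes>\<^bsub>?S\<^esub> p = p"
    using full_trans_regular[OF hp(2)] by blast
  define z where "z = y \<otimes>\<^bsub>?S\<^esub> a \<otimes>\<^bsub>?S\<^esub> u \<otimes>\<^bsub>?S\<^esub> a \<otimes>\<^bsub>?S\<^esub> x"
  have z: "z \<in> carrier ?S" using a fx gy u by (simp add: z_def)
  have "h = f \<otimes>\<^bsub>?S\<^esub> p \<otimes>\<^bsub>?S\<^esub> g"
    using a fx gy by (simp add: p_def h_def m_assoc fe' ge0)
  also have "\<dots> = f \<otimes>\<^bsub>?S\<^esub> (p \<otimes>\<^bsub>?S\<^esub> u \<otimes>\<^bsub>?S\<^esub> p) \<otimes>\<^bsub>?S\<^esub> g"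
    using u by simp
  also have "\<dots> = h \<otimes>\<^bsub>?S\<^esub> a \<otimes>\<^bsub>?S\<^esub> z \<otimes>\<^bsub>?S\<^esub> a \<otimes>\<^bsub>?S\<^esub> h"
    using a fx gy u(1) by (simp add: p_def h_def z_def m_assoc fe' ge' ge0)
  finally have hz: "h \<otimes>\<^bsub>?S\<^esub> a \<otimes>\<^bsub>?S\<^esub> z \<otimes>\<^bsub>?S\<^esub> a \<otimes>\<^bsub>?S\<^esub> h = h" ..
  have hz0: "h \<otimes>\<^bsub>?S\<^esub> (a \<otimes>\<^bsub>?S\<^esub> (z \<otimes>\<^bsub>?S\<^esub> (a \<otimes>\<^bsub>?S\<^esub> h))) = h"
    using hz a z hp by (simp add: m_assoc)
  have hz': "h \<otimes>\<^bsub>?S\<^esub> (a \<otimes>\<^bsub>?S\<^esub> (z \<otimes>\<^bsub>?S\<^esub> (a \<otimes>\<^bsub>?S\<^esub> (h \<otimes>\<^bsub>?S\<^esub> w)))) = h \<otimes>\<^bsub>?S\<^esub> w"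
    if "w \<in> carrier ?S" for w
    using arg_cong[OF hz, of "\<lambda>t. t \<otimes>\<^bsub>?S\<^esub> w"] that a z hp by (simp add: m_assoc)
  define z' where "z' = z \<otimes>\<^bsub>?S\<^esub> a \<otimes>\<^bsub>?S\<^esub> h \<otimes>\<^bsub>?S\<^esub> a \<otimes>\<^bsub>?S\<^esub> z"
  have "z' \<in> carrier ?S" "h = h \<otimes>\<^bsub>?S\<^esub> a \<otimes>\<^bsub>?S\<^esub> z' \<otimes>\<^bsub>?S\<^esub> a \<otimes>\<^bsub>?S\<^esub> h"
      "z' = z' \<otimes>\<^bsub>?S\<^esub> a \<otimes>\<^bsub>?S\<^esub> h \<otimes>\<^bsub>?S\<^esub> a \<otimes>\<^bsub>?S\<^esub> z'"
    using a z hp by (simp_all add: z'_def m_assoc hz0 hz')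
  then have "h \<in> carrier (Reg (variant ?S a))"
    using hp unfolding Reg_def regular_elem_def variant_def by auto
  then show ?thesis by (simp add: h_def)
qed

lemma psi1_hom:
  assumes a: "a \<in> carrier (full_trans X)"
  shows "psi1 X a \<in> hom (Reg (variant (full_trans X) a)) (Reg (trans_im X (map_im X a)))"
proof -
  interpret monoid "full_trans X" by (rule monoid_full_trans)
  let ?S = "full_trans X"
  have im: "t \<otimes>\<^bsub>?S\<^esub> a \<in> carrier (trans_im X (map_im X a))" if "t \<in> carrier ?S" for t
    using that m_closed[OF that a]
    by (auto simp: trans_im_def map_im_def full_trans_def compose_def)
  have cl: "f \<otimes>\<^bsub>?S\<^esub> a \<in> carrier (Reg (trans_im X (map_im X a)))"
    if f: "f \<in> carrier (Reg (variant ?S a))" for f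
  proof -
    from f obtain y where y: "f \<in> carrier ?S" "y \<in> carrier ?S"
        and e: "f = f \<otimes>\<^bsub>?S\<^esub> a \<otimes>\<^bsub>?S\<^esub> y \<otimes>\<^bsub>?S\<^esub> a \<otimes>\<^bsub>?S\<^esub> f" "y = y \<otimes>\<^bsub>?S\<^esub> a \<otimes>\<^bsub>?S\<^esub> f \<otimes>\<^bsub>?S\<^esub> a \<otimes>\<^bsub>?S\<^esub> y"
      by (auto simp: Reg_def regular_elem_def variant_def)
    have "f \<otimes>\<^bsub>?S\<^esub> a = (f \<otimes>\<^bsub>?S\<^esub> a) \<otimes>\<^bsub>?S\<^esub> (y \<otimes>\<^bsub>?S\<^esub> a) \<otimes>\<^bsub>?S\<^esub> (f \<otimes>\<^bsub>?S\<^esub> a)"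
      using arg_cong[OF e(1)[symmetric], of "\<lambda>t. t \<otimes>\<^bsub>?S\<^esub> a"] y a by (simp add: m_assoc)
    moreover have "y \<otimes>\<^bsub>?S\<^esub> a = (y \<otimes>\<^bsub>?S\<^esub> a) \<otimes>\<^bsub>?S\<^esub> (f \<otimes>\<^bsub>?S\<^esub> a) \<otimes>\<^bsub>?S\<^esub> (y \<otimes>\<^bsub>?S\<^esub> a)"
      using arg_cong[OF e(2)[symmetric], of "\<lambda>t. t \<otimes>\<^bsub>?S\<^esub> a"] y a by (simp add: m_assoc)
    ultimately show ?thesis
      using im[OF y(1)] im[OF y(2)]
      unfolding Reg_def regular_elem_def trans_im_def by auto
  qed
  have in_S: "f \<in> carrier ?S" if "f \<in> carrier (Reg (variant ?S a))" for f
    using that by (simp add: Reg_def variant_def)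
  have mult_dom: "f \<otimes>\<^bsub>Reg (variant ?S a)\<^esub> g = f \<otimes>\<^bsub>?S\<^esub> a \<otimes>\<^bsub>?S\<^esub> g" for f g
    by (simp add: Reg_def variant_def)
  have mult_cod: "f \<otimes>\<^bsub>Reg (trans_im X (map_im X a))\<^esub> g = f \<otimes>\<^bsub>?S\<^esub> g" for f g
    by (simp add: Reg_def trans_im_def)
  show ?thesis
    by (rule homI)
      (simp_all add: psi1_def mult_dom mult_cod variant_reg_closed[OF a] cl in_S a,
       simp_all add: in_S a m_assoc)
qed

lemma psi2_hom:
  assumes a: "a \<in> carrier (full_trans X)"
  shows "psi2 X a \<in> hom (Reg (variant (full_trans X) a)) (Reg (trans_ker X (map_ker X a)))"
proof -
  interpret monoid "full_trans X" by (rule monoid_full_trans)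
  let ?S = "full_trans X"
  have ker: "a \<otimes>\<^bsub>?S\<^esub> t \<in> carrier (trans_ker X (map_ker X a))" if "t \<in> carrier ?S" for t
    using that m_closed[OF a that]
    by (auto simp: trans_ker_def map_ker_def full_trans_def compose_def)
  have cl: "a \<otimes>\<^bsub>?S\<^esub> f \<in> carrier (Reg (trans_ker X (map_ker X a)))"
    if f: "f \<in> carrier (Reg (variant ?S a))" for f
  proof -
    from f obtain y where y: "f \<in> carrier ?S" "y \<in> carrier ?S"
        and e: "f = f \<otimes>\<^bsub>?S\<^esub> a \<otimes>\<^bsub>?S\<^esub> y \<otimes>\<^bsub>?S\<^esub> a \<otimes>\<^bsub>?S\<^esub> f" "y = y \<otimes>\<^bsub>?S\<^esub> a \<otimes>\<^bsub>?S\<^esub> f \<otimes>\<^bsub>?S\<^esub> a \<otimes>\<^bsub>?S\<^esub> y"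
      by (auto simp: Reg_def regular_elem_def variant_def)
    have "a \<otimes>\<^bsub>?S\<^esub> f = (a \<otimes>\<^bsub>?S\<^esub> f) \<otimes>\<^bsub>?S\<^esub> (a \<otimes>\<^bsub>?S\<^esub> y) \<otimes>\<^bsub>?S\<^esub> (a \<otimes>\<^bsub>?S\<^esub> f)"
      using arg_cong[OF e(1)[symmetric], of "\<lambda>t. a \<otimes>\<^bsub>?S\<^esub> t"] y a by (simp add: m_assoc)
    moreover have "a \<otimes>\<^bsub>?S\<^esub> y = (a \<otimes>\<^bsub>?S\<^esub> y) \<otimes>\<^bsub>?S\<^esub> (a \<otimes>\<^bsub>?S\<^esub> f) \<otimes>\<^bsub>?S\<^esub> (a \<otimes>\<^bsub>?S\<^esub> y)"
      using arg_cong[OF e(2)[symmetric], of "\<lambda>t. a \<otimes>\<^bsub>?S\<^esub> t"] y a by (simp add: m_assoc)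
    ultimately show ?thesis
      using ker[OF y(1)] ker[OF y(2)]
      unfolding Reg_def regular_elem_def trans_ker_def by auto
  qed
  have in_S: "f \<in> carrier ?S" if "f \<in> carrier (Reg (variant ?S a))" for f
    using that by (simp add: Reg_def variant_def)
  have mult_dom: "f \<otimes>\<^bsub>Reg (variant ?S a)\<^esub> g = f \<otimes>\<^bsub>?S\<^esub> a \<otimes>\<^bsub>?S\<^esub> g" for f g
    by (simp add: Reg_def variant_def)
  have mult_cod: "f \<otimes>\<^bsub>Reg (trans_ker X (map_ker X a))\<^esub> g = f \<otimes>\<^bsub>?S\<^esub> g" for f g
    by (simp add: Reg_def trans_ker_def)
  show ?thesis
    by (rule homI)
      (simp_all add: psi2_def mult_dom mult_cod variant_reg_closed[OF a] cl in_S a,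
       simp_all add: in_S a m_assoc)
qed

end

theory Submission
  imports Defs
begin

text \<open>
  Regularity has a pointwise description in each of the two subsemigroups: a map
  \<open>f\<close> is regular in \<open>T(X, A)\<close> iff every value of \<open>f\<close> is already attained on \<open>A\<close>, and
  regular in \<open>T(X, \<alpha>)\<close> iff distinct values of \<open>f\<close> are never \<open>\<alpha>\<close>-related
  (\<open>Reg_trans_im_iff\<close>, \<open>Reg_trans_ker_iff\<close>). Both conditions are visibly stable under
  composition, so the regular elements form subsemigroups, and \<open>\<phi>\<^sub>1\<close>, \<open>\<phi>\<^sub>2\<close> are
  homomorphisms: for \<open>\<phi>\<^sub>1\<close> because maps into \<open>A\<close> can be restricted to \<open>A\<close> before composing,
  and for \<open>\<phi>\<^sub>2\<close> because \<open>a z\<close> and \<open>z\<close> are related by \<open>\<alpha> = ker a\<close> and so are identified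
  by every map in \<open>T(X, \<alpha>)\<close>.

  The square commutes since \<open>a\<close> fixes \<open>A\<close> pointwise. For surjectivity it is then enough to treat
  the diagonal: given \<open>h\<close> in the full transformation semigroup on \<open>A\<close>, the product \<open>a h\<close> (first \<open>a\<close>,
  then \<open>h\<close>) is regular in the variant (an inverse \<open>h'\<close> of \<open>h\<close> yields \<open>a h'\<close>), and it is sent to \<open>h\<close>. Surjectivity of
  \<open>\<phi>\<^sub>1\<close> and \<open>\<phi>\<^sub>2\<close> follows from that of the diagonal.
\<close>

section \<open>Products in the transformation semigroups\<close>

lemma full_trans_simps [simp]:
  "carrier (full_trans Y) = Y \<rightarrow>\<^sub>E Y"
  "f \<otimes>\<^bsub>full_trans Y\<^esub> g = compose Y g f"
  by (simp_all add: full_trans_def)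

lemma Reg_simps [simp]:
  "f \<in> carrier (Reg S) \<longleftrightarrow> f \<in> carrier S \<and> regular_elem S f"
  "f \<otimes>\<^bsub>Reg S\<^esub> g = f \<otimes>\<^bsub>S\<^esub> g"
  by (simp_all add: Reg_def)

lemma variant_simps [simp]:
  "carrier (variant S a) = carrier S"
  "f \<otimes>\<^bsub>variant S a\<^esub> g = f \<otimes>\<^bsub>S\<^esub> a \<otimes>\<^bsub>S\<^esub> g"
  by (simp_all add: variant_def)

lemma trans_im_simps [simp]:
  "f \<in> carrier (trans_im X A) \<longleftrightarrow> f \<in> X \<rightarrow>\<^sub>E X \<and> f ` X \<subseteq> A"
  "f \<otimes>\<^bsub>trans_im X A\<^esub> g = compose X g f"
  by (simp_all add: trans_im_def map_im_def)

lemma trans_ker_simps [simp]: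
  "f \<in> carrier (trans_ker X \<alpha>) \<longleftrightarrow> f \<in> X \<rightarrow>\<^sub>E X \<and> \<alpha> \<subseteq> map_ker X f"
  "f \<otimes>\<^bsub>trans_ker X \<alpha>\<^esub> g = compose X g f"
  by (simp_all add: trans_ker_def)

lemma compose_PiE [simp]: "f \<in> X \<rightarrow>\<^sub>E X \<Longrightarrow> g \<in> X \<rightarrow>\<^sub>E X \<Longrightarrow> compose X g f \<in> X \<rightarrow>\<^sub>E X"
  by (auto simp: compose_def)

section \<open>Regular elements of \<open>T(X, A)\<close> and \<open>T(X, \<alpha>)\<close>\<close>

text \<open>One of the two defining equations suffices: if \<open>x u x = x\<close>, then \<open>u x u\<close> is an inverse of \<open>x\<close>.\<close>

lemma regular_elemI:
  fixes S (structure)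
  assumes closed: "\<And>x y. x \<in> carrier S \<Longrightarrow> y \<in> carrier S \<Longrightarrow> x \<otimes> y \<in> carrier S"
    and assoc: "\<And>x y z. x \<in> carrier S \<Longrightarrow> y \<in> carrier S \<Longrightarrow> z \<in> carrier S
                  \<Longrightarrow> x \<otimes> y \<otimes> z = x \<otimes> (y \<otimes> z)"
    and x: "x \<in> carrier S" and u: "u \<in> carrier S" and xux: "x \<otimes> u \<otimes> x = x"
  shows "regular_elem S x"
proof -
  have xux': "x \<otimes> (u \<otimes> x) = x"
    using xux x u by (simp add: assoc)
  have xuxw: "x \<otimes> (u \<otimes> (x \<otimes> w)) = x \<otimes> w" if "w \<in> carrier S" for w
    using xux x u that by (metis assoc closed)
  have "u \<otimes> x \<otimes> u \<in> carrier S" "x = x \<otimes> (u \<otimes> x \<otimes> u) \<otimes> x"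
    "u \<otimes> x \<otimes> u = u \<otimes> x \<otimes> u \<otimes> x \<otimes> (u \<otimes> x \<otimes> u)"
    using x u by (simp_all add: assoc closed xux' xuxw)
  then show ?thesis
    unfolding regular_elem_def by blast
qed

lemma Reg_trans_im_iff:
  assumes "A \<subseteq> X"
  shows "f \<in> carrier (Reg (trans_im X A)) \<longleftrightarrow> f \<in> X \<rightarrow>\<^sub>E X \<and> f ` X \<subseteq> A \<and> f ` X \<subseteq> f ` A"
proof
  assume f: "f \<in> carrier (Reg (trans_im X A))"
  then obtain y where y: "y ` X \<subseteq> A" and e: "f = compose X f (compose X y f)"
    by (auto simp: regular_elem_def)
  have "f x \<in> f ` A" if "x \<in> X" for x
  proof -
    have "f x = f (y (f x))"
      using fun_cong[OF e, of x] that by (simp add: compose_def)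
    moreover have "y (f x) \<in> A"
      using f y that by auto
    ultimately show ?thesis by blast
  qed
  with f show "f \<in> X \<rightarrow>\<^sub>E X \<and> f ` X \<subseteq> A \<and> f ` X \<subseteq> f ` A"
    by auto
next
  assume f: "f \<in> X \<rightarrow>\<^sub>E X \<and> f ` X \<subseteq> A \<and> f ` X \<subseteq> f ` A"
  \<comment> \<open>Off the image of \<open>f\<close> any values in \<open>A\<close> will do; those of \<open>f\<close> itself are at hand.\<close>
  define u where "u = (\<lambda>z\<in>X. if z \<in> f ` A then inv_into A f z else f z)"
  have u: "u \<in> X \<rightarrow>\<^sub>E X" "u ` X \<subseteq> A"
    using f assms by (auto simp: u_def inv_into_into subset_iff)
  have "f (u (f x)) = f x" if "x \<in> X" for x
    using f that by (auto simp: u_def image_subset_iff f_inv_into_f)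
  then have fuf: "compose X f (compose X u f) = f"
    using f by (auto simp: compose_def fun_eq_iff PiE_def extensional_def)
  have "regular_elem (trans_im X A) f"
  proof (rule regular_elemI[where u = u])
    show "x \<otimes>\<^bsub>trans_im X A\<^esub> y \<in> carrier (trans_im X A)"
      if "x \<in> carrier (trans_im X A)" "y \<in> carrier (trans_im X A)" for x y
      using that by simp (auto simp: compose_def image_subset_iff)
  qed (use f u fuf in \<open>auto simp: compose_def fun_eq_iff\<close>)
  with f show "f \<in> carrier (Reg (trans_im X A))"
    by simp
qed

lemma Reg_trans_ker_iff:
  assumes \<alpha>: "equiv X \<alpha>"
  shows "f \<in> carrier (Reg (trans_ker X \<alpha>)) \<longleftrightarrow>
    f \<in> X \<rightarrow>\<^sub>E X \<and> \<alpha> \<subseteq> map_ker X f \<and> (\<forall>x\<in>X. \<forall>y\<in>X. (f x, f y) \<in> \<alpha> \<longrightarrow> f x = f y)"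
proof
  assume f: "f \<in> carrier (Reg (trans_ker X \<alpha>))"
  then obtain u where u: "\<alpha> \<subseteq> map_ker X u" and e: "f = compose X f (compose X u f)"
    by (auto simp: regular_elem_def)
  have fuf: "f x = f (u (f x))" if "x \<in> X" for x
    using fun_cong[OF e, of x] that by (simp add: compose_def)
  have "f x = f y" if "x \<in> X" "y \<in> X" "(f x, f y) \<in> \<alpha>" for x y
  proof -
    have "u (f x) = u (f y)"
      using u that by (auto simp: map_ker_def)
    then show ?thesis
      using fuf that by metis
  qed
  with f show "f \<in> X \<rightarrow>\<^sub>E X \<and> \<alpha> \<subseteq> map_ker X f \<and> (\<forall>x\<in>X. \<forall>y\<in>X. (f x, f y) \<in> \<alpha> \<longrightarrow> f x = f y)"
    by auto
next
  assume f: "f \<in> X \<rightarrow>\<^sub>E X \<and> \<alpha> \<subseteq> map_ker X f \<and> (\<forall>x\<in>X. \<forall>y\<in>X. (f x, f y) \<in> \<alpha> \<longrightarrow> f x = f y)"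
  \<comment> \<open>Preimages are chosen per \<open>\<alpha>\<close>-class, so that \<open>u\<close> is constant on the classes; on classes
      missing the image of \<open>f\<close>, the map \<open>f\<close> itself is constant.\<close>
  define P where "P = (\<lambda>z x. x \<in> X \<and> (z, f x) \<in> \<alpha>)"
  define u where "u = (\<lambda>z\<in>X. if \<exists>x. P z x then SOME x. P z x else f z)"
  have P: "P z (SOME x. P z x)" if "P z x" for z x
    using that by (rule someI)
  have uX: "u \<in> X \<rightarrow>\<^sub>E X"
    using f P by (auto simp: u_def P_def)
  have "u y = u z" if "(y, z) \<in> \<alpha>" for y z
  proof -
    have "y \<in> X" "z \<in> X" "f y = f z"
      using f that by (auto simp: map_ker_def)
    moreover have "P y = P z"
      using \<alpha> that unfolding P_def equiv_def fun_eq_iff by (meson symD transD)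
    ultimately show ?thesis
      by (auto simp: u_def)
  qed
  then have u\<alpha>: "\<alpha> \<subseteq> map_ker X u"
    using f by (auto simp: map_ker_def)
  have "f (u (f x)) = f x" if x: "x \<in> X" for x
  proof -
    have "f x \<in> X"
      using f x by auto
    then have "P (f x) x"
      using \<alpha> x by (simp add: P_def equiv_def refl_on_def)
    then have "u (f x) = (SOME x'. P (f x) x')" and "P (f x) (SOME x'. P (f x) x')"
      using \<open>f x \<in> X\<close> P by (auto simp: u_def)
    then have "u (f x) \<in> X" "(f x, f (u (f x))) \<in> \<alpha>"
      unfolding P_def by simp_all
    with f x show ?thesis
      by metis
  qed
  then have fuf: "compose X f (compose X u f) = f"
    using f by (auto simp: compose_def fun_eq_iff PiE_def extensional_def)
  have "regular_elem (trans_ker X \<alpha>) f"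
  proof (rule regular_elemI[where u = u])
    show "x \<otimes>\<^bsub>trans_ker X \<alpha>\<^esub> y \<in> carrier (trans_ker X \<alpha>)"
      if "x \<in> carrier (trans_ker X \<alpha>)" "y \<in> carrier (trans_ker X \<alpha>)" for x y
      using that by simp (auto simp: map_ker_def compose_def)
  qed (use f uX u\<alpha> fuf in \<open>auto simp: compose_def fun_eq_iff\<close>)
  with f show "f \<in> carrier (Reg (trans_ker X \<alpha>))"
    by simp
qed

lemma equiv_map_ker: "equiv X (map_ker X a)"
  by (auto simp: map_ker_def equiv_def refl_on_def sym_def trans_def)

section \<open>The homomorphisms induced by an idempotent\<close>

context
  fixes X :: "'a set" and a :: "'a \<Rightarrow> 'a"
  assumes a: "a \<in> carrier (full_trans X)" and idem: "a \<otimes>\<^bsub>full_trans X\<^esub> a = a"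
begin

lemma idem_apply: "x \<in> X \<Longrightarrow> a (a x) = a x"
  using fun_cong[OF idem, of x] by (simp add: compose_def)

lemma idem_fixes_im: "x \<in> map_im X a \<Longrightarrow> a x = x"
  by (auto simp: map_im_def idem_apply)

lemma map_im_subset: "map_im X a \<subseteq> X"
  using a by (auto simp: map_im_def)

lemma phi1_hom: "phi1 X a \<in> hom (Reg (trans_im X (map_im X a))) (full_trans (map_im X a))"
  (is "_ \<in> hom ?R _")
proof (rule homI)
  show "phi1 X a f \<in> carrier (full_trans (map_im X a))" if "f \<in> carrier ?R" for f
    using that map_im_subset by (auto simp: phi1_def)
next
  fix f g assume f: "f \<in> carrier ?R" and g: "g \<in> carrier ?R"
  have fg: "f \<otimes>\<^bsub>?R\<^esub> g \<in> carrier ?R"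
  proof -
    have f': "f \<in> X \<rightarrow>\<^sub>E X" "f ` X \<subseteq> f ` map_im X a"
      and g': "g \<in> X \<rightarrow>\<^sub>E X" "g ` X \<subseteq> map_im X a"
      using f g unfolding Reg_trans_im_iff[OF map_im_subset] by simp_all
    have "compose X g f ` X = g ` f ` X" "compose X g f ` map_im X a = g ` f ` map_im X a"
      using map_im_subset by (auto simp: compose_def image_image subset_iff)
    moreover have "g ` f ` X \<subseteq> g ` X"
      using f'(1) by auto
    moreover have "g ` f ` X \<subseteq> g ` f ` map_im X a"
      using f'(2) by (rule image_mono)
    ultimately show ?thesis
      using f' g' unfolding Reg_trans_im_iff[OF map_im_subset] by simp
  qed
  have "restrict (compose X g f) (map_im X a)
      = compose (map_im X a) (restrict g (map_im X a)) (restrict f (map_im X a))"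
    using f map_im_subset by (auto simp: compose_def fun_eq_iff)
  then show "phi1 X a (f \<otimes>\<^bsub>?R\<^esub> g) = phi1 X a f \<otimes>\<^bsub>full_trans (map_im X a)\<^esub> phi1 X a g"
    using f g fg unfolding phi1_def by simp
qed

lemma phi2_hom: "phi2 X a \<in> hom (Reg (trans_ker X (map_ker X a))) (full_trans (map_im X a))"
  (is "_ \<in> hom ?R _")
proof (rule homI)
  show "phi2 X a f \<in> carrier (full_trans (map_im X a))" if "f \<in> carrier ?R" for f
  proof -
    have "compose X a f x \<in> map_im X a" if "x \<in> map_im X a" for x
    proof -
      have "x \<in> X" using that map_im_subset by blast
      moreover from this have "f x \<in> X" using \<open>f \<in> carrier ?R\<close> by auto
      ultimately show ?thesis by (simp add: compose_def map_im_def)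
    qed
    with that show ?thesis
      unfolding phi2_def by simp
  qed
next
  fix f g assume f: "f \<in> carrier ?R" and g: "g \<in> carrier ?R"
  have fg: "f \<otimes>\<^bsub>?R\<^esub> g \<in> carrier ?R"
  proof -
    have f': "f \<in> X \<rightarrow>\<^sub>E X" "map_ker X a \<subseteq> map_ker X f"
      and g': "g \<in> X \<rightarrow>\<^sub>E X"
        "\<And>x y. x \<in> X \<Longrightarrow> y \<in> X \<Longrightarrow> (g x, g y) \<in> map_ker X a \<Longrightarrow> g x = g y"
      using f g unfolding Reg_trans_ker_iff[OF equiv_map_ker] by blast+
    have fX: "f x \<in> X" if "x \<in> X" for x
      using f'(1) that by auto
    have "map_ker X a \<subseteq> map_ker X (compose X g f)"
      using f'(2) by (auto simp: map_ker_def compose_def)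
    moreover have "compose X g f x = compose X g f y"
      if "x \<in> X" "y \<in> X" "(compose X g f x, compose X g f y) \<in> map_ker X a" for x y
      using g'(2)[of "f x" "f y"] fX that by (simp add: compose_def)
    ultimately show ?thesis
      using f'(1) g'(1) unfolding Reg_trans_ker_iff[OF equiv_map_ker] by simp
  qed
  have ga: "g (a z) = g z" if "z \<in> X" for z
  proof -
    have "(a z, z) \<in> map_ker X a"
      using a that by (auto simp: map_ker_def idem_apply)
    then show ?thesis
      using g by (auto simp: map_ker_def)
  qed
  have "restrict (compose X a (compose X g f)) (map_im X a)
      = compose (map_im X a) (restrict (compose X a g) (map_im X a))
          (restrict (compose X a f) (map_im X a))"
  proof (rule ext)
    fix x
    show "restrict (compose X a (compose X g f)) (map_im X a) x
      = compose (map_im X a) (restrict (compose X a g) (map_im X a))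
          (restrict (compose X a f) (map_im X a)) x"
    proof (cases "x \<in> map_im X a")
      case True
      then have "x \<in> X" using map_im_subset by blast
      then have "f x \<in> X" using f by auto
      then have "a (f x) \<in> map_im X a" "a (f x) \<in> X"
        using a by (auto simp: map_im_def)
      then show ?thesis
        using True \<open>x \<in> X\<close> \<open>f x \<in> X\<close> ga by (simp add: compose_def)
    qed (simp add: compose_def)
  qed
  then show "phi2 X a (f \<otimes>\<^bsub>?R\<^esub> g) = phi2 X a f \<otimes>\<^bsub>full_trans (map_im X a)\<^esub> phi2 X a g"
    using f g fg unfolding phi2_def by simp
qed

lemma phi_psi_apply:
  assumes f: "f \<in> carrier (Reg (variant (full_trans X) a))"
  shows "phi1 X a (psi1 X a f) = restrict (compose X a f) (map_im X a)"
    and "phi2 X a (psi2 X a f) = restrict (compose X a f) (map_im X a)"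
proof -
  have "psi1 X a f \<in> carrier (Reg (trans_im X (map_im X a)))"
    using psi1_hom[OF a] f by (rule hom_in_carrier)
  moreover have "psi1 X a f = compose X a f"
    using f unfolding psi1_def by simp
  ultimately show "phi1 X a (psi1 X a f) = restrict (compose X a f) (map_im X a)"
    unfolding phi1_def by simp
  have "psi2 X a f \<in> carrier (Reg (trans_ker X (map_ker X a)))"
    using psi2_hom[OF a] f by (rule hom_in_carrier)
  moreover have "psi2 X a f = compose X f a"
    using f unfolding psi2_def by simp
  moreover have "restrict (compose X a (compose X f a)) (map_im X a)
      = restrict (compose X a f) (map_im X a)"
    using map_im_subset by (auto simp: compose_def fun_eq_iff idem_fixes_im)
  ultimately show "phi2 X a (psi2 X a f) = restrict (compose X a f) (map_im X a)"
    unfolding phi2_def by simp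
qed

lemma diagonal_surj:
  assumes h: "h \<in> carrier (full_trans (map_im X a))"
  shows "\<exists>f \<in> carrier (Reg (variant (full_trans X) a)). phi1 X a (psi1 X a f) = h"
proof
  let ?A = "map_im X a" and ?f = "compose X h a"
  have aA: "a x \<in> ?A" if "x \<in> X" for x
    using that by (simp add: map_im_def)
  have lift: "compose X k a \<in> X \<rightarrow>\<^sub>E X" if "k \<in> ?A \<rightarrow>\<^sub>E ?A" for k
    using that aA map_im_subset by (auto simp: compose_def)
  obtain u where u: "u \<in> ?A \<rightarrow>\<^sub>E ?A" and huh: "compose ?A h (compose ?A u h) = h"
    using full_trans_regular[OF h] by auto
  have huh': "h (u (h x)) = h x" if "x \<in> ?A" for x
    using fun_cong[OF huh, of x] that by (simp add: compose_def)
  have hA: "h x \<in> ?A" "u x \<in> ?A" if "x \<in> ?A" for x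
    using h u that by auto
  have AX: "x \<in> X" if "x \<in> ?A" for x
    using that map_im_subset by blast
  have "regular_elem (variant (full_trans X) a) ?f"
  proof (rule regular_elemI[where u = "compose X u a"])
    show "?f \<otimes>\<^bsub>variant (full_trans X) a\<^esub> compose X u a \<otimes>\<^bsub>variant (full_trans X) a\<^esub> ?f = ?f"
      by (auto simp: compose_def fun_eq_iff idem_fixes_im aA hA AX huh')
    show "x \<otimes>\<^bsub>variant (full_trans X) a\<^esub> y \<in> carrier (variant (full_trans X) a)"
      if "x \<in> carrier (variant (full_trans X) a)" "y \<in> carrier (variant (full_trans X) a)" for x y
      using that a by simp
    show "x \<otimes>\<^bsub>variant (full_trans X) a\<^esub> y \<otimes>\<^bsub>variant (full_trans X) a\<^esub> z
        = x \<otimes>\<^bsub>variant (full_trans X) a\<^esub> (y \<otimes>\<^bsub>variant (full_trans X) a\<^esub> z)"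
      if "x \<in> carrier (variant (full_trans X) a)" "y \<in> carrier (variant (full_trans X) a)"
        "z \<in> carrier (variant (full_trans X) a)" for x y z
      using that a by (auto simp: compose_def fun_eq_iff)
  qed (use h u lift in simp_all)
  then show f: "?f \<in> carrier (Reg (variant (full_trans X) a))"
    using h lift by simp
  have "restrict (compose X a ?f) ?A = h"
  proof (rule ext)
    show "restrict (compose X a ?f) ?A x = h x" for x
    proof (cases "x \<in> ?A")
      case False
      then show ?thesis
        using PiE_arb[of h ?A "\<lambda>_. ?A" x] h by simp
    qed (simp add: compose_def idem_fixes_im hA AX)
  qed
  then show "phi1 X a (psi1 X a ?f) = h"
    by (simp only: phi_psi_apply(1)[OF f])
qed

end

theorem proposition5p5:
  fixes X A :: "'a set" and a :: "'a \<Rightarrow> 'a" and \<alpha> :: "('a \<times> 'a) set" and n r :: nat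
  assumes "finite X" and "card X = n"
    and "a \<in> carrier (full_trans X)" and "a \<otimes>\<^bsub>full_trans X\<^esub> a = a"
    and "r = map_rank X a" and "1 < r" and "r < n"
    and "A = map_im X a" and "\<alpha> = map_ker X a"
  shows "phi1 X a \<in> epi (Reg (trans_im X A)) (full_trans A)
    \<and> phi2 X a \<in> epi (Reg (trans_ker X \<alpha>)) (full_trans A)
    \<and> (\<forall>f \<in> carrier (Reg (variant (full_trans X) a)).
          phi1 X a (psi1 X a f) = phi2 X a (psi2 X a f))
    \<and> (\<lambda>f. phi1 X a (psi1 X a f)) \<in> epi (Reg (variant (full_trans X) a)) (full_trans A)"
proof -
  note a = assms(3) and idem = assms(4) and A = assms(8) and \<alpha> = assms(9)
  let ?V = "Reg (variant (full_trans X) a)"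
  have hom1: "phi1 X a \<in> hom (Reg (trans_im X A)) (full_trans A)"
    using phi1_hom[OF a idem] by (simp only: A)
  have hom2: "phi2 X a \<in> hom (Reg (trans_ker X \<alpha>)) (full_trans A)"
    using phi2_hom[OF a idem] by (simp only: A \<alpha>)
  have psi1: "psi1 X a \<in> hom ?V (Reg (trans_im X A))"
    using psi1_hom[OF a] by (simp only: A)
  have psi2: "psi2 X a \<in> hom ?V (Reg (trans_ker X \<alpha>))"
    using psi2_hom[OF a] by (simp only: \<alpha>)
  have square: "\<forall>f \<in> carrier ?V. phi1 X a (psi1 X a f) = phi2 X a (psi2 X a f)"
    using phi_psi_apply[OF a idem] by metis
  have surj: "\<exists>f \<in> carrier ?V. phi1 X a (psi1 X a f) = h" if "h \<in> carrier (full_trans A)" for h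
    using diagonal_surj[OF a idem] that unfolding A .
  have epi1: "phi1 X a \<circ> psi1 X a \<in> epi ?V (full_trans A)"
    using hom_compose[OF psi1 hom1] surj hom_in_carrier[OF hom_compose[OF psi1 hom1]]
    unfolding epi_def by fastforce
  moreover have "(phi1 X a \<circ> psi1 X a) ` carrier ?V = (phi2 X a \<circ> psi2 X a) ` carrier ?V"
    by (rule image_cong) (use square in \<open>simp_all only: comp_apply\<close>)
  ultimately have epi2: "phi2 X a \<circ> psi2 X a \<in> epi ?V (full_trans A)"
    using hom_compose[OF psi2 hom2] unfolding epi_def by simp
  show ?thesis
    using epi_compose_rev[OF psi1 hom1 epi1] epi_compose_rev[OF psi2 hom2 epi2] square epi1
    unfolding comp_def by blast
qed

end
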